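(* For any $C^*$-algebra $A$ and any projection $p\in A$, the space $S_p(H_A)=\{x\in H_A:\langle x,x\rangle=p\}$ is contractible.
   Context: $H_A=\{(a_n)_{n\in\mathbb N}: a_n\in A,\ \sum_n a_n^*a_n \text{ converges in norm}\}$ is the standard right Hilbert $C^*$-module over $A$, with action $(a_n)b=(a_nb)$ and $A$-valued inner product $\langle(a_n),(b_n)\rangle=\sum_n a_n^*b_n$. $S_p(H_A)$ has the norm topology. Projection means self-adjoint idempotent. *)

theory Defs
  imports "HOL-Analysis.Analysis"
begin

text \<open>
  Complex \<open>C\<^sup>*\<close>-algebras, not assumed unital; the zero algebra is allowed.
  The library has Banach algebras over the reals only, so the complex scalar multiplication is
  added here and required to extend the real one.
\<close>

class cstar_algebra = real_normed_algebra + banach +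
  fixes scaleC :: "complex \<Rightarrow> 'a \<Rightarrow> 'a"  (infixr \<open>*\<^sub>C\<close> 75)
    and adj :: "'a \<Rightarrow> 'a"
  assumes scaleC_add_right: "c *\<^sub>C (x + y) = c *\<^sub>C x + c *\<^sub>C y"
    and scaleC_add_left: "(c + d) *\<^sub>C x = c *\<^sub>C x + d *\<^sub>C x"
    and scaleC_scaleC: "c *\<^sub>C d *\<^sub>C x = (c * d) *\<^sub>C x"
    and scaleC_of_real: "complex_of_real r *\<^sub>C x = r *\<^sub>R x"
    and norm_scaleC: "norm (c *\<^sub>C x) = cmod c * norm x"
    and mult_scaleC_left: "(c *\<^sub>C x) * y = c *\<^sub>C (x * y)"
    and mult_scaleC_right: "x * (c *\<^sub>C y) = c *\<^sub>C (x * y)"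
    and adj_adj: "adj (adj x) = x"
    and adj_add: "adj (x + y) = adj x + adj y"
    and adj_scaleC: "adj (c *\<^sub>C x) = cnj c *\<^sub>C adj x"
    and adj_mult: "adj (x * y) = adj y * adj x"
    and norm_adj_mult_self: "norm (adj x * x) = (norm x)\<^sup>2"

definition projection :: "'a::cstar_algebra \<Rightarrow> bool" where
  "projection p \<longleftrightarrow> adj p = p \<and> p * p = p"

definition hilbert_module :: "(nat \<Rightarrow> 'a::cstar_algebra) set" where
  "hilbert_module = {a. summable (\<lambda>n. adj (a n) * a n)}"

definition module_inner :: "(nat \<Rightarrow> 'a::cstar_algebra) \<Rightarrow> (nat \<Rightarrow> 'a) \<Rightarrow> 'a" where
  "module_inner a b = (\<Sum>n. adj (a n) * b n)"

definition module_norm :: "(nat \<Rightarrow> 'a::cstar_algebra) \<Rightarrow> real" where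
  "module_norm a = sqrt (norm (module_inner a a))"

definition module_dist :: "(nat \<Rightarrow> 'a::cstar_algebra) \<Rightarrow> (nat \<Rightarrow> 'a) \<Rightarrow> real" where
  "module_dist a b = module_norm (\<lambda>n. a n - b n)"

definition hilbert_module_topology :: "(nat \<Rightarrow> 'a::cstar_algebra) topology" where
  "hilbert_module_topology = Metric_space.mtopology hilbert_module module_dist"

definition module_sphere :: "'a::cstar_algebra \<Rightarrow> (nat \<Rightarrow> 'a) set" where
  "module_sphere p = {x \<in> hilbert_module. module_inner x x = p}"

end

theory Submission
  imports Defs
begin

text \<open>
  The coordinates of \<open>x\<close> are moved one place to the right, one at a time, by plane rotations with
  scalar coefficients, infinitely many of them being performed during the time interval \<open>(0,1]\<close>; since the tails
  of \<open>x\<close> are small, the path is continuous at time 0. It preserves \<open>\<langle>x,x\<rangle>\<close> and ends at the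
  shift of \<open>x\<close>, which is orthogonal to \<open>(p,0,0,\<dots>)\<close> and can be rotated into it.

  That the module norm is a norm, and that scalar weights bounded by 1 do not increase it, rests on
  \<open>\<parallel>\<Sum> a\<^sub>n\<^sup>* a\<^sub>n\<parallel> \<le> \<parallel>\<Sum> a\<^sub>n\<^sup>* a\<^sub>n + \<Sum> b\<^sub>m\<^sup>* b\<^sub>m\<parallel>\<close>. This is obtained without spectral theory, from square roots
  given by the binomial series of \<open>1 - (1 - s)\<^sup>1\<^sup>/\<^sup>2\<close> and from \<open>\<parallel>l\<^sup>2\<parallel> \<le> \<parallel>l\<^sup>2 + k\<^sup>2\<parallel>\<close> for commuting self-adjoint
  \<open>l\<close> and \<open>k\<close>. The unitization enters only through its action \<open>x \<mapsto> t x + a x\<close> on the algebra.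
\<close>

section \<open>Square roots\<close>

lemma norm_adj [simp]: "norm (adj x) = norm (x::'a::cstar_algebra)"
proof -
  have le: "norm y \<le> norm (adj y)" for y :: 'a
  proof (cases "y = 0")
    case False
    have "norm y * norm y \<le> norm (adj y) * norm y"
      using norm_mult_ineq[of "adj y" y] norm_adj_mult_self[of y] by (simp add: power2_eq_square)
    then show ?thesis using False by simp
  qed simp
  show ?thesis using le[of x] le[of "adj x"] by (simp add: adj_adj)
qed

lemma adj_scaleR: "adj (r *\<^sub>R x) = r *\<^sub>R adj (x::'a::cstar_algebra)"
  by (metis adj_scaleC complex_cnj_complex_of_real scaleC_of_real)

lemma bounded_linear_adj: "bounded_linear (adj :: 'a::cstar_algebra \<Rightarrow> 'a)"
  by (rule bounded_linear_intro[where K = 1]) (simp_all add: adj_add adj_scaleR)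

lemmas adj_0 = bounded_linear.linear[OF bounded_linear_adj, THEN linear_0]
lemmas adj_minus = bounded_linear.linear[OF bounded_linear_adj, THEN linear_neg]
lemmas adj_diff = bounded_linear.linear[OF bounded_linear_adj, THEN linear_diff]

lemmas adj_simps = adj_adj adj_add adj_mult adj_scaleR adj_scaleC adj_0 adj_minus adj_diff

lemma norm_mult_self: "adj h = h \<Longrightarrow> norm (h * h) = (norm (h::'a::cstar_algebra))\<^sup>2"
  by (metis norm_adj_mult_self)

text \<open>Testing at \<open>adj a\<close> brings in the C*-identity. This turns bounds on left
  multiplication back into norm bounds.\<close>

lemma norm_le_action:
  fixes a :: "'a::cstar_algebra"
  assumes "0 \<le> C" "\<And>x. norm (a * x) \<le> C * norm x"
  shows "norm a \<le> C"
proof (cases "a = 0")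
  case False
  have "norm a * norm a \<le> C * norm a"
    using assms(2)[of "adj a"] norm_adj_mult_self[of "adj a"] by (simp add: adj_adj power2_eq_square)
  then show ?thesis using False by simp
qed (simp add: assms)

lemma scaleC_i_i: "\<i> *\<^sub>C \<i> *\<^sub>C x = - (x::'a::cstar_algebra)"
  using scaleC_scaleC[of \<i> \<i> x] scaleC_of_real[of "-1" x] by simp

lemma scaleC_minus_left: "(- c) *\<^sub>C x = - (c *\<^sub>C (x::'a::cstar_algebra))"
  using scaleC_add_left[of "-c" c x] scaleC_of_real[of 0 x]
  by (simp add: eq_neg_iff_add_eq_0)

lemma additive_scaleC: "Modules.additive (scaleC c :: 'a::cstar_algebra \<Rightarrow> 'a)"
  by unfold_locales (rule scaleC_add_right)

lemmas scaleC_minus_right = Modules.additive.minus[OF additive_scaleC]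
lemmas scaleC_diff_right = Modules.additive.diff[OF additive_scaleC]

text \<open>The elements \<open>u + i g\<close> and \<open>u - i g\<close> both have square norm \<open>\<parallel>u\<^sup>* u + g\<^sup>* g\<parallel>\<close>, and \<open>g\<close> is
  half their difference up to the factor \<open>i\<close>.\<close>

lemma norm_le_norm_sum_squares:
  fixes u g :: "'a::cstar_algebra"
  assumes "adj u * g = adj g * u"
  shows "(norm g)\<^sup>2 \<le> norm (adj u * u + adj g * g)"
proof -
  let ?n = "u + \<i> *\<^sub>C g" and ?m = "u - \<i> *\<^sub>C g" and ?s = "adj u * u + adj g * g"
  have "adj ?n * ?n = ?s" "adj ?m * ?m = ?s"
    by (simp_all add: adj_simps algebra_simps mult_scaleC_left mult_scaleC_right scaleC_minus_left
        scaleC_minus_right scaleC_add_right scaleC_diff_right scaleC_i_i assms)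
  then have n: "(norm ?n)\<^sup>2 = norm ?s" and m: "(norm ?m)\<^sup>2 = norm ?s"
    using norm_adj_mult_self by metis+
  have "2 *\<^sub>R (\<i> *\<^sub>C g) = ?n - ?m" by (simp add: scaleR_2)
  then have "2 * norm g \<le> norm ?n + norm ?m"
    by (metis norm_scaleC norm_scaleR norm_triangle_ineq4 norm_ii mult_1 abs_numeral real_norm_def)
  moreover have "norm ?n = norm ?m" using n m by (metis norm_ge_zero power2_eq_iff_nonneg)
  ultimately have "norm g \<le> norm ?n" by simp
  then show ?thesis using n by (metis norm_ge_zero power_mono)
qed

lemma norm_square_le_commuting:
  fixes l k :: "'a::cstar_algebra"
  assumes "adj l = l" "adj k = k" "l * k = k * l"
  shows "norm (l * l) \<le> norm (l * l + k * k)"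
  using norm_le_norm_sum_squares[of k l] assms by (simp add: norm_mult_self add.commute)

text \<open>The power series \<open>f\<close> of \<open>1 - (1 - s)\<^sup>1\<^sup>/\<^sup>2\<close> is determined by \<open>2 f = s + f\<^sup>2\<close> and \<open>f(0) = 0\<close>.\<close>

fun sqrt_coeff :: "nat \<Rightarrow> real" where
  "sqrt_coeff n = (if n = 0 then 0 else if n = 1 then 1/2
     else (\<Sum>i\<in>{1..<n}. sqrt_coeff i * sqrt_coeff (n - i)) / 2)"

declare sqrt_coeff.simps [simp del]

lemma sqrt_coeff_0 [simp]: "sqrt_coeff 0 = 0"
  by (simp add: sqrt_coeff.simps)

lemma sqrt_coeff_nonneg: "0 \<le> sqrt_coeff n"
proof (induction n rule: less_induct)
  case (less n)
  then show ?case by (subst sqrt_coeff.simps) (auto intro!: sum_nonneg)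
qed

text \<open>The coefficients of \<open>f^2 = 2 f - s\<close>: the end terms vanish as
  \<open>sqrt_coeff 0 = 0\<close>, and the correction at \<open>n = 1\<close> is
  \<open>s\<close>.\<close>

lemma sqrt_coeff_convolution:
  "(\<Sum>i\<le>n. sqrt_coeff i * sqrt_coeff (n - i)) = 2 * sqrt_coeff n - (if n = 1 then 1 else 0)"
proof -
  have "(\<Sum>i\<le>n. sqrt_coeff i * sqrt_coeff (n - i)) = (\<Sum>i\<in>{1..<n}. sqrt_coeff i * sqrt_coeff (n - i))"
    by (rule sum.mono_neutral_right) (auto simp: not_less le_less)
  also have "\<dots> = 2 * sqrt_coeff n - (if n = 1 then 1 else 0)"
    by (subst (3) sqrt_coeff.simps) auto
  finally show ?thesis .
qed

definition sqrt_psum :: "nat \<Rightarrow> real" where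
  "sqrt_psum N = (\<Sum>n\<le>N. sqrt_coeff n)"

text \<open>With powers for \<open>v\<close>, this is \<open>f^2 = 2 f - s\<close> truncated at
  total degree \<open>N\<close>.\<close>

lemma sqrt_triangle_sum:
  fixes v :: "nat \<Rightarrow> 'a::real_vector"
  assumes "1 \<le> N"
  shows "(\<Sum>(n,m)\<in>{(n,m). n + m \<le> N}. (sqrt_coeff n * sqrt_coeff m) *\<^sub>R v (n + m))
    = 2 *\<^sub>R (\<Sum>k\<le>N. sqrt_coeff k *\<^sub>R v k) - v 1"
proof -
  have "(\<Sum>(n,m)\<in>{(n,m). n + m \<le> N}. (sqrt_coeff n * sqrt_coeff m) *\<^sub>R v (n + m))
    = (\<Sum>k\<le>N. \<Sum>i\<le>k. (sqrt_coeff i * sqrt_coeff (k - i)) *\<^sub>R v (i + (k - i)))"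
    by (rule sum.triangle_reindex_eq)
  also have "\<dots> = (\<Sum>k\<le>N. (\<Sum>i\<le>k. sqrt_coeff i * sqrt_coeff (k - i)) *\<^sub>R v k)"
    by (simp add: scaleR_sum_left)
  also have "\<dots> = (\<Sum>k\<le>N. 2 *\<^sub>R sqrt_coeff k *\<^sub>R v k - (if k = 1 then v k else 0))"
    by (intro sum.cong refl) (simp add: sqrt_coeff_convolution algebra_simps)
  also have "\<dots> = 2 *\<^sub>R (\<Sum>k\<le>N. sqrt_coeff k *\<^sub>R v k) - v 1"
    using assms by (simp add: sum_subtractf scaleR_sum_right)
  finally show ?thesis .
qed

lemma sqrt_psum_triangle:
  "1 \<le> N \<Longrightarrow> (\<Sum>(n,m)\<in>{(n,m). n + m \<le> N}. sqrt_coeff n * sqrt_coeff m) = 2 * sqrt_psum N - 1"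
  using sqrt_triangle_sum[of N "\<lambda>_. 1::real"] by (simp add: sqrt_psum_def)

lemma sqrt_psum_square:
  "(\<Sum>(n,m)\<in>{..N} \<times> {..M}. sqrt_coeff n * sqrt_coeff m) = sqrt_psum N * sqrt_psum M"
  by (simp add: sqrt_psum_def sum_product sum.cartesian_product)

lemma finite_triangle [simp]: "finite {(n,m). n + m \<le> (N::nat)}"
  by (rule finite_subset[of _ "{..N} \<times> {..N}"]) auto

lemma sqrt_psum_nonneg: "0 \<le> sqrt_psum N"
  by (simp add: sqrt_psum_def sum_nonneg sqrt_coeff_nonneg)

text \<open>Apart from terms with a zero index, the triangle of size \<open>Suc N\<close> lies in
  the square of side \<open>N\<close>, so consecutive partial sums satisfy
  \<open>2 s' - 1 <= s^2 <= 1\<close>.\<close>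

lemma sqrt_psum_le_1: "sqrt_psum N \<le> 1"
proof (induction N)
  case 0
  show ?case by (simp add: sqrt_psum_def)
next
  case (Suc N)
  have "2 * sqrt_psum (Suc N) - 1 = (\<Sum>(n,m)\<in>{(n,m). n + m \<le> Suc N}. sqrt_coeff n * sqrt_coeff m)"
    by (simp add: sqrt_psum_triangle)
  also have "\<dots> = (\<Sum>(n,m)\<in>{(n,m). n + m \<le> Suc N} \<inter> {..N} \<times> {..N}. sqrt_coeff n * sqrt_coeff m)"
  proof -
    have "sqrt_coeff n * sqrt_coeff m = 0" if "n + m \<le> Suc N" "\<not> (n \<le> N \<and> m \<le> N)" for n m
    proof -
      have "n = 0 \<or> m = 0" using that by linarith
      then show ?thesis by auto
    qed
    then show ?thesis by (intro sum.mono_neutral_right finite_triangle) (auto, blast+)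
  qed
  also have "\<dots> \<le> (\<Sum>(n,m)\<in>{..N} \<times> {..N}. sqrt_coeff n * sqrt_coeff m)"
    by (rule sum_mono2) (auto simp: sqrt_coeff_nonneg)
  also have "\<dots> \<le> 1"
    using Suc.IH sqrt_psum_nonneg[of N] by (simp add: sqrt_psum_square mult_le_one)
  finally show ?case by simp
qed

text \<open>A limit \<open>T\<close> exists by monotonicity. The square of side \<open>N\<close>
  fits into the triangle of size \<open>2 N + 1\<close>, so \<open>T^2 <= 2 T - 1\<close>, which
  leaves only \<open>T = 1\<close>.\<close>

lemma sqrt_psum_tendsto_1: "sqrt_psum \<longlonglongrightarrow> 1"
proof -
  have "mono sqrt_psum"
    by (rule monoI) (auto simp: sqrt_psum_def sqrt_coeff_nonneg intro!: sum_mono2)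
  then obtain T where T: "sqrt_psum \<longlonglongrightarrow> T"
    using incseq_convergent[of sqrt_psum 1] sqrt_psum_le_1 by metis
  have "sqrt_psum N * sqrt_psum N \<le> 2 * sqrt_psum (Suc (2 * N)) - 1" for N
    unfolding sqrt_psum_square[symmetric] sqrt_psum_triangle[of "Suc (2 * N)", simplified, symmetric]
    by (rule sum_mono2) (auto simp: sqrt_coeff_nonneg)
  moreover have "(\<lambda>N. sqrt_psum (Suc (2 * N))) \<longlonglongrightarrow> T"
    using LIMSEQ_subseq_LIMSEQ[OF T, of "\<lambda>N. Suc (2 * N)"] by (simp add: strict_mono_def o_def)
  ultimately have "T * T \<le> 2 * T - 1"
    by (intro LIMSEQ_le[of "\<lambda>N. sqrt_psum N * sqrt_psum N" _ "\<lambda>N. 2 * sqrt_psum (Suc (2 * N)) - 1"])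
      (auto intro!: tendsto_intros T)
  then have "(T - 1)\<^sup>2 \<le> 0" by (simp add: power2_eq_square algebra_simps)
  then show ?thesis using T by simp
qed

text \<open>Only index pairs in the square but outside the triangle remain; with
  \<open>S = sqrt_psum N\<close> their coefficients add up to
  \<open>S^2 - (2 S - 1)\<close>.\<close>

lemma sqrt_double_sum_bound:
  fixes v :: "nat \<Rightarrow> 'a::real_normed_vector"
  assumes "1 \<le> N" and v: "\<And>n. norm (v n) \<le> B"
  shows "norm ((\<Sum>n\<le>N. \<Sum>m\<le>N. (sqrt_coeff n * sqrt_coeff m) *\<^sub>R v (n + m))
      - (2 *\<^sub>R (\<Sum>k\<le>N. sqrt_coeff k *\<^sub>R v k) - v 1)) \<le> B * (1 - sqrt_psum N)\<^sup>2"
proof -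
  let ?Q = "{..N} \<times> {..N}" and ?T = "{(n,m). n + m \<le> N}"
  let ?f = "\<lambda>(n,m). (sqrt_coeff n * sqrt_coeff m) *\<^sub>R v (n + m)"
  let ?c = "\<lambda>(n,m). sqrt_coeff n * sqrt_coeff m"
  have sub: "?T \<subseteq> ?Q" by auto
  have "norm (sum ?f ?Q - sum ?f ?T) = norm (sum ?f (?Q - ?T))"
    using sum_diff[OF _ sub, of ?f] by simp
  also have "\<dots> \<le> (\<Sum>z\<in>?Q - ?T. B * ?c z)"
    by (rule sum_norm_le) (auto simp: sqrt_coeff_nonneg mult.commute[of B] intro!: mult_left_mono v)
  also have "\<dots> = B * (sum ?c ?Q - sum ?c ?T)"
    using sum_diff[OF _ sub, of ?c] by (simp only: sum_distrib_left[symmetric]) simp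
  also have "\<dots> = B * (1 - sqrt_psum N)\<^sup>2"
    by (simp add: sqrt_psum_square sqrt_psum_triangle[OF assms(1)] power2_eq_square algebra_simps)
  finally show ?thesis
    by (simp add: sqrt_triangle_sum[OF assms(1)] sum.cartesian_product)
qed

text \<open>\<open>shifted_power l a n\<close> is \<open>(l + a)\<^sup>n - l\<^sup>n\<close>, computed in the unitization; it lies in the algebra.\<close>

primrec shifted_power :: "real \<Rightarrow> 'a::cstar_algebra \<Rightarrow> nat \<Rightarrow> 'a" where
  "shifted_power l a 0 = 0"
| "shifted_power l a (Suc n) = l *\<^sub>R shifted_power l a n + l ^ n *\<^sub>R a + shifted_power l a n * a"

text \<open>This is \<open>(l + a)^n (l + a)^m = (l + a)^(n + m)\<close> without the scalar part
  \<open>l^(n + m)\<close>.\<close>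

lemma shifted_power_add:
  "shifted_power l a n * shifted_power l a m + l ^ n *\<^sub>R shifted_power l a m
     + l ^ m *\<^sub>R shifted_power l a n = shifted_power l a (n + m)"
proof (induction m)
  case (Suc m)
  have "shifted_power l a (n + Suc m)
    = l *\<^sub>R shifted_power l a (n + m) + l ^ (n + m) *\<^sub>R a + shifted_power l a (n + m) * a"
    by simp
  also have "\<dots> = shifted_power l a n * shifted_power l a (Suc m)
      + l ^ n *\<^sub>R shifted_power l a (Suc m) + l ^ Suc m *\<^sub>R shifted_power l a n"
    unfolding Suc.IH[symmetric] by (simp add: algebra_simps power_add)
  finally show ?case by simp
qed simp

lemma shifted_power_commute:
  "g * a = a * g \<Longrightarrow> shifted_power l a n * g = g * shifted_power l a n"
proof (induction n)
  case (Suc n)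
  then show ?case by (simp add: algebra_simps) (metis mult.assoc)
qed simp

lemma adj_shifted_power: "adj a = a \<Longrightarrow> adj (shifted_power l a n) = shifted_power l a n"
  by (induction n) (simp_all add: adj_simps shifted_power_commute)

lemma shifted_power_action:
  fixes a :: "'a::cstar_algebra"
  assumes "\<And>x. norm (l *\<^sub>R x + a * x) \<le> norm x"
  shows "norm (l ^ n *\<^sub>R x + shifted_power l a n * x) \<le> norm x"
proof (induction n arbitrary: x)
  case (Suc n)
  have "l ^ Suc n *\<^sub>R x + shifted_power l a (Suc n) * x
    = l ^ n *\<^sub>R (l *\<^sub>R x + a * x) + shifted_power l a n * (l *\<^sub>R x + a * x)"
    by (simp add: algebra_simps)
  then show ?case using order_trans[OF Suc.IH assms, of x] by (simp only:)
qed simp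

text \<open>Powers of \<open>l + a\<close> act as contractions; removing the scalar
  \<open>l ^ n\<close> costs at most another 1.\<close>

lemma norm_shifted_power_le:
  fixes a :: "'a::cstar_algebra"
  assumes "\<And>x. norm (l *\<^sub>R x + a * x) \<le> norm x" and "\<bar>l\<bar> \<le> 1"
  shows "norm (shifted_power l a n) \<le> 2"
proof (rule norm_le_action)
  fix x
  have "norm (shifted_power l a n * x) \<le> norm (l ^ n *\<^sub>R x + shifted_power l a n * x) + norm (l ^ n *\<^sub>R x)"
    by (metis add_diff_cancel_left' norm_triangle_ineq4)
  also have "\<dots> \<le> norm x + norm x"
    using shifted_power_action[OF assms(1)] assms(2)
    by (intro add_mono) (simp_all add: power_abs power_le_one mult_left_le_one_le)
  finally show "norm (shifted_power l a n * x) \<le> 2 * norm x" by simp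
qed simp

text \<open>\<open>l + f = \<Sum> sqrt_coeff n (l + a)\<^sup>n\<close> is \<open>1 - (1 - (l + a))\<^sup>1\<^sup>/\<^sup>2\<close> in the unitization.\<close>

lemma sqrt_series:
  fixes a :: "'a::cstar_algebra"
  assumes l: "l = 0 \<or> l = 1" and sa: "adj a = a"
    and act: "\<And>x. norm (l *\<^sub>R x + a * x) \<le> norm x"
  obtains f where "adj f = f" "f * f = (2 * (1 - l)) *\<^sub>R f - a"
    "\<And>g. g * a = a * g \<Longrightarrow> g * f = f * g"
    "\<And>x. norm (l *\<^sub>R x + f * x) \<le> norm x"
proof -
  let ?A = "shifted_power l a"
  define F where "F = (\<lambda>N. \<Sum>n\<le>N. sqrt_coeff n *\<^sub>R ?A n)"
  have bd: "norm (?A n) \<le> 2" for n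
    using norm_shifted_power_le[OF act] l by auto
  have "sqrt_coeff sums 1"
    using sqrt_psum_tendsto_1 by (simp add: sums_def_le sqrt_psum_def[abs_def])
  then have "summable sqrt_coeff" by (rule sums_summable)
  then have "summable (\<lambda>n. sqrt_coeff n *\<^sub>R ?A n)"
    by (rule summable_comparison_test'[OF summable_mult2[of _ 2], where N = 0])
      (simp add: sqrt_coeff_nonneg mult_left_mono bd)
  then obtain f where f: "F \<longlonglongrightarrow> f"
    unfolding F_def using summable_LIMSEQ' by blast
  have FN: "F N = (\<Sum>n\<le>N. sqrt_coeff n *\<^sub>R ?A n)" for N
    by (simp add: F_def)
  \<comment> \<open>For \<open>l = 0\<close> both sides vanish because
    \<open>sqrt_coeff 0 = 0\<close>; for \<open>l = 1\<close> they agree termwise.\<close>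
  have lsum: "(\<Sum>n\<le>N. sqrt_coeff n * l ^ n) = l * sqrt_psum N" for N
    using l by (auto simp: sqrt_psum_def power_0_left if_distrib cong: if_cong)
  have sq: "F N * F N = (\<Sum>n\<le>N. \<Sum>m\<le>N. (sqrt_coeff n * sqrt_coeff m) *\<^sub>R ?A (n + m))
      - (2 * l * sqrt_psum N) *\<^sub>R F N" for N
  proof -
    have "(\<Sum>n\<le>N. \<Sum>m\<le>N. (sqrt_coeff n * sqrt_coeff m) *\<^sub>R ?A (n + m))
      = (\<Sum>n\<le>N. \<Sum>m\<le>N. (sqrt_coeff n *\<^sub>R ?A n) * (sqrt_coeff m *\<^sub>R ?A m)
          + (sqrt_coeff n * l ^ n) *\<^sub>R (sqrt_coeff m *\<^sub>R ?A m)
          + (sqrt_coeff m * l ^ m) *\<^sub>R (sqrt_coeff n *\<^sub>R ?A n))"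
      by (simp add: shifted_power_add[symmetric] algebra_simps)
    also have "\<dots> = F N * F N + (\<Sum>n\<le>N. sqrt_coeff n * l ^ n) *\<^sub>R F N
        + (\<Sum>n\<le>N. sqrt_coeff n * l ^ n) *\<^sub>R F N"
      unfolding F_def sum.distrib
      by (simp only: sum_product scaleR_sum_left[symmetric] scaleR_sum_right[symmetric])
    finally show ?thesis by (simp add: lsum algebra_simps flip: scaleR_add_left)
  qed
  have "(\<lambda>N. F N * F N + (2 * l * sqrt_psum N) *\<^sub>R F N - (2 *\<^sub>R F N - a)) \<longlonglongrightarrow> 0"
  proof (rule Lim_null_comparison)
    show "\<forall>\<^sub>F N in sequentially. norm (F N * F N + (2 * l * sqrt_psum N) *\<^sub>R F N - (2 *\<^sub>R F N - a))
        \<le> 2 * (1 - sqrt_psum N)\<^sup>2"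
      using eventually_ge_at_top[of 1]
    proof eventually_elim
      case (elim N)
      then show ?case
        using sqrt_double_sum_bound[of N ?A 2] bd by (simp add: sq FN[symmetric])
    qed
    show "(\<lambda>N. 2 * (1 - sqrt_psum N)\<^sup>2) \<longlonglongrightarrow> 0"
      by (auto intro!: tendsto_eq_intros sqrt_psum_tendsto_1)
  qed
  moreover have "(\<lambda>N. F N * F N + (2 * l * sqrt_psum N) *\<^sub>R F N - (2 *\<^sub>R F N - a))
      \<longlonglongrightarrow> f * f + (2 * l * 1) *\<^sub>R f - (2 *\<^sub>R f - a)"
    by (intro tendsto_intros f sqrt_psum_tendsto_1)
  ultimately have "f * f + (2 * l * 1) *\<^sub>R f - (2 *\<^sub>R f - a) = 0"
    using LIMSEQ_unique by blast
  then have ff: "f * f = (2 * (1 - l)) *\<^sub>R f - a"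
    by (simp add: algebra_simps)
  have "(\<lambda>N. adj (F N)) \<longlonglongrightarrow> adj f"
    by (rule bounded_linear.tendsto[OF bounded_linear_adj f])
  moreover have "adj (F N) = F N" for N
    unfolding F_def bounded_linear.linear[OF bounded_linear_adj, THEN linear_sum]
    by (simp add: adj_scaleR adj_shifted_power sa)
  ultimately have sa_f: "adj f = f" using f LIMSEQ_unique by auto
  have com: "g * f = f * g" if "g * a = a * g" for g
  proof -
    have "F N * g = g * F N" for N
      by (simp add: F_def sum_distrib_left sum_distrib_right shifted_power_commute that)
    then have "(\<lambda>N. g * F N) \<longlonglongrightarrow> f * g"
      using tendsto_mult_right[OF f, of g] by simp
    then show ?thesis using tendsto_mult_left[OF f, of g] LIMSEQ_unique by blast
  qed
  have "norm (l *\<^sub>R x + f * x) \<le> norm x" for x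
  proof (rule Lim_norm_ubound)
    show "(\<lambda>N. (l * sqrt_psum N) *\<^sub>R x + F N * x) \<longlonglongrightarrow> l *\<^sub>R x + f * x"
      by (auto intro!: tendsto_eq_intros sqrt_psum_tendsto_1 f)
    have "norm ((l * sqrt_psum N) *\<^sub>R x + F N * x) \<le> norm x" for N
    proof -
      \<comment> \<open>The contractions \<open>(l + a)^n\<close> are combined with nonnegative
        weights of sum at most 1.\<close>
      have "(l * sqrt_psum N) *\<^sub>R x + F N * x = (\<Sum>n\<le>N. sqrt_coeff n *\<^sub>R (l ^ n *\<^sub>R x + ?A n * x))"
        by (simp add: F_def lsum[symmetric] sum.distrib scaleR_sum_left sum_distrib_right algebra_simps)
      also have "norm \<dots> \<le> (\<Sum>n\<le>N. sqrt_coeff n * norm x)"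
        by (rule sum_norm_le) (simp add: sqrt_coeff_nonneg mult_left_mono shifted_power_action[OF act])
      also have "\<dots> \<le> norm x"
        by (simp add: sum_distrib_right[symmetric] sqrt_psum_def[symmetric] sqrt_psum_le_1 sqrt_psum_nonneg
            mult_left_le_one_le)
      finally show ?thesis .
    qed
    then show "\<forall>\<^sub>F N in sequentially. norm ((l * sqrt_psum N) *\<^sub>R x + F N * x) \<le> norm x"
      by simp
  qed simp
  then show thesis using that ff sa_f com by blast
qed

section \<open>Positive elements\<close>

text \<open>In the unitization, \<open>positive_element h\<close> says that \<open>\<parallel>t - h\<parallel> \<le> t\<close> for some (hence every larger) \<open>t\<close>. In this
  form it is obvious that sums of positive elements are positive.\<close>

definition positive_element :: "'a::cstar_algebra \<Rightarrow> bool" where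
  "positive_element h \<longleftrightarrow> adj h = h \<and> (\<exists>t>0. \<forall>x. norm (t *\<^sub>R x - h * x) \<le> t * norm x)"

lemma positive_adj: "positive_element h \<Longrightarrow> adj h = h"
  by (simp add: positive_element_def)

lemma positive_0 [simp]: "positive_element 0"
  by (auto simp: positive_element_def adj_0 intro!: exI[of _ 1])

lemma positive_add:
  assumes "positive_element h" "positive_element k"
  shows "positive_element (h + k)"
proof -
  obtain s t where s: "s > 0" "\<And>x. norm (s *\<^sub>R x - h * x) \<le> s * norm x"
    and t: "t > 0" "\<And>x. norm (t *\<^sub>R x - k * x) \<le> t * norm x"
    using assms unfolding positive_element_def by blast
  have "norm ((s + t) *\<^sub>R x - (h + k) * x) \<le> (s + t) * norm x" for x
    using norm_triangle_ineq[of "s *\<^sub>R x - h * x" "t *\<^sub>R x - k * x"] s(2)[of x] t(2)[of x]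
    by (simp add: algebra_simps)
  then show ?thesis
    using assms s(1) t(1) by (auto simp: positive_element_def adj_add intro!: exI[of _ "s + t"])
qed

lemma positive_scaleR:
  assumes "positive_element h" "0 \<le> r"
  shows "positive_element (r *\<^sub>R h)"
proof (cases "r = 0")
  case False
  obtain t where t: "t > 0" "\<And>x. norm (t *\<^sub>R x - h * x) \<le> t * norm x"
    using assms unfolding positive_element_def by blast
  have "norm ((r * t) *\<^sub>R x - (r *\<^sub>R h) * x) \<le> (r * t) * norm x" for x
  proof -
    have "norm ((r * t) *\<^sub>R x - (r *\<^sub>R h) * x) = r * norm (t *\<^sub>R x - h * x)"
      using assms(2) by (metis abs_of_nonneg mult_scaleR_left norm_scaleR scaleR_diff_right scaleR_scaleR)
    then show ?thesis using t(2)[of x] assms(2) by (simp add: mult.assoc mult_left_mono)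
  qed
  then show ?thesis
    using assms False t(1) unfolding positive_element_def
    by (auto simp: adj_scaleR intro!: exI[of _ "r * t"])
qed simp

lemma positive_sum: "(\<And>i. i \<in> I \<Longrightarrow> positive_element (f i)) \<Longrightarrow> positive_element (sum f I)"
  by (induction I rule: infinite_finite_induct) (auto intro: positive_add)

text \<open>Since \<open>h / t = 1 - (1 - h / t)\<close>, the series with \<open>l = 1\<close> and
  \<open>a = - h / t\<close> gives \<open>1 + f = 1 - (h / t)^(1/2)\<close>. Hence
  \<open>k = - sqrt t f\<close>, and the contraction bound for \<open>1 + f\<close> is the
  positivity of \<open>k\<close>.\<close>

lemma positive_sqrt:
  assumes "positive_element h"
  obtains k where "positive_element k" "k * k = h" "\<And>g. g * h = h * g \<Longrightarrow> g * k = k * g"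
proof -
  obtain t where t: "t > 0" "\<And>x. norm (t *\<^sub>R x - h * x) \<le> t * norm x"
    using assms unfolding positive_element_def by blast
  let ?a = "- (1 / t) *\<^sub>R h"
  have act: "norm (1 *\<^sub>R x + ?a * x) \<le> norm x" for x
  proof -
    have "1 *\<^sub>R x + ?a * x = (1 / t) *\<^sub>R (t *\<^sub>R x - h * x)"
      using t(1) by (simp add: algebra_simps)
    then have "norm (1 *\<^sub>R x + ?a * x) = norm (t *\<^sub>R x - h * x) / t"
      using t(1) by simp
    then show ?thesis using t by (simp add: divide_le_eq mult.commute)
  qed
  have sa: "adj ?a = ?a" using positive_adj[OF assms] by (simp add: adj_simps)
  obtain f where f: "adj f = f" "f * f = (2 * (1 - 1)) *\<^sub>R f - ?a"
    "\<And>g. g * ?a = ?a * g \<Longrightarrow> g * f = f * g" "\<And>x. norm (1 *\<^sub>R x + f * x) \<le> norm x"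
    by (rule sqrt_series[OF disjI2[OF refl] sa act]) (rule that)
  define k where "k = - sqrt t *\<^sub>R f"
  have "norm (sqrt t *\<^sub>R x - k * x) \<le> sqrt t * norm x" for x
  proof -
    have "sqrt t *\<^sub>R x - k * x = sqrt t *\<^sub>R (1 *\<^sub>R x + f * x)"
      by (simp add: k_def algebra_simps)
    then show ?thesis using f(4)[of x] t(1) by (simp add: mult_left_mono)
  qed
  then have "positive_element k"
    unfolding positive_element_def using t(1) f(1) by (auto simp: k_def adj_simps intro!: exI[of _ "sqrt t"])
  moreover have "k * k = h"
    using f(2) t(1) by (simp add: k_def)
  moreover have "g * k = k * g" if "g * h = h * g" for g
    using f(3)[of g] that by (simp add: k_def)
  ultimately show thesis using that by blast
qed

text \<open>The series with \<open>l = 0\<close>: \<open>f\<close> is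
  \<open>1 - (1 - a)^(1/2)\<close>, that is, \<open>(1 - f)^2 = 1 - a\<close>.\<close>

lemma contraction_sqrt:
  fixes a :: "'a::cstar_algebra"
  assumes "adj a = a" "norm a \<le> 1"
  obtains f where "adj f = f" "f * f = 2 *\<^sub>R f - a" "\<And>g. g * a = a * g \<Longrightarrow> g * f = f * g"
proof -
  have "norm (0 *\<^sub>R x + a * x) \<le> norm x" for x
    using norm_mult_ineq[of a x] mult_left_le_one_le[of "norm x" "norm a"] assms(2) by simp
  then show thesis
    using sqrt_series[of 0 a] assms(1) that by (metis diff_zero mult.right_neutral)
qed

text \<open>\<open>1 - f = (1 - h\<^sup>2)\<^sup>1\<^sup>/\<^sup>2\<close> satisfies \<open>h\<^sup>2 + (1 - f)\<^sup>2 = 1\<close>, so it is a contraction.\<close>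

lemma square_action:
  fixes h :: "'a::cstar_algebra"
  assumes "adj h = h" "norm h \<le> 1"
  shows "norm (x - h * h * x) \<le> norm x"
proof -
  have "norm (h * h) \<le> 1" using assms by (simp add: norm_mult_self power_le_one)
  then obtain f where f: "adj f = f" "f * f = 2 *\<^sub>R f - h * h" "h * f = f * h"
    using contraction_sqrt[of "h * h"] assms(1) by (metis adj_mult mult.assoc)
  have ffx: "f * (f * y) = 2 *\<^sub>R (f * y) - h * (h * y)" for y
    using arg_cong[OF f(2), of "\<lambda>z. z * y"] by (simp add: algebra_simps)
  have hfx: "h * (f * y) = f * (h * y)" for y
    using arg_cong[OF f(3), of "\<lambda>z. z * y"] by (simp add: algebra_simps)
  have le: "norm (y - f * y) \<le> norm y" for y
  proof -
    let ?u = "h * y" and ?g = "y - f * y"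
    have "adj ?u * ?g = adj ?g * ?u"
      by (simp add: adj_simps assms(1) f(1) algebra_simps hfx)
    moreover have "adj ?u * ?u + adj ?g * ?g = adj y * y"
      by (simp add: adj_simps assms(1) f(1) algebra_simps ffx scaleR_2)
    ultimately show ?thesis
      using norm_le_norm_sum_squares[of ?u ?g] by (simp add: norm_adj_mult_self)
  qed
  \<comment> \<open>As \<open>1 - h^2 = (1 - f)^2\<close>, the contraction \<open>1 - f\<close> is
    applied twice.\<close>
  have "x - h * h * x = (x - f * x) - f * (x - f * x)"
    by (simp add: algebra_simps ffx scaleR_2)
  then show ?thesis using le order_trans by metis
qed

lemma positive_square:
  fixes h :: "'a::cstar_algebra"
  assumes "adj h = h"
  shows "positive_element (h * h)"
proof (cases "h = 0")
  case False
  let ?n = "norm h" and ?g = "(1 / norm h) *\<^sub>R h"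
  have "norm (x - ?g * ?g * x) \<le> norm x" for x
    by (rule square_action) (use False assms in \<open>auto simp: adj_scaleR\<close>)
  then have "positive_element (?g * ?g)"
    unfolding positive_element_def by (auto simp: adj_simps assms intro!: exI[of _ 1])
  then have "positive_element ((?n * ?n) *\<^sub>R (?g * ?g))"
    by (rule positive_scaleR) simp
  then show ?thesis using False by simp
qed simp

section \<open>Positivity of \<open>adj x * x\<close>\<close>

lemma positive_adj_mult_add_mult_adj: "positive_element (adj z * z + z * adj z)"
proof -
  \<comment> \<open>Twice the real part of \<open>z\<close> and, up to sign, twice its imaginary
    part.\<close>
  let ?a = "z + adj z" and ?b = "\<i> *\<^sub>C (z - adj z)"
  have "adj ?a = ?a" by (simp add: adj_simps)
  moreover have "adj ?b = ?b"
    by (simp add: adj_simps scaleC_minus_left scaleC_diff_right)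
  ultimately have "positive_element (?a * ?a + ?b * ?b)"
    by (intro positive_add positive_square)
  then have "positive_element ((1 / 2) *\<^sub>R (?a * ?a + ?b * ?b))"
    by (rule positive_scaleR) simp
  also have "?a * ?a + ?b * ?b = 2 *\<^sub>R (adj z * z + z * adj z)"
    by (simp add: mult_scaleC_left mult_scaleC_right scaleC_i_i scaleC_diff_right algebra_simps scaleR_2)
  finally show ?thesis by simp
qed

text \<open>With \<open>w = z\<^sup>* z = - c\<^sup>2\<close> and \<open>v = z z\<^sup>*\<close>, which is positive by the preceding lemma,
  \<open>w (1 - w)\<^sup>n = z\<^sup>* (1 - v)\<^sup>n z\<close> stays bounded, whereas \<open>c\<^sup>2 (1 + c\<^sup>2)\<^sup>n\<close> dominates \<open>n c\<^sup>4\<close>.\<close>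

lemma adj_mult_self_eq_neg_square_aux:
  fixes z c :: "'a::cstar_algebra"
  assumes c: "adj c = c" and zc: "adj z * z = - (c * c)" and z: "norm z = 1"
  shows "c = 0"
proof -
  have "z * adj z = (adj z * z + z * adj z) + c * c" by (simp add: zc)
  then have "positive_element (z * adj z)"
    by (metis positive_adj_mult_add_mult_adj positive_add positive_square c)
  then obtain d where d: "positive_element d" "d * d = z * adj z"
    using positive_sqrt by blast
  have "(norm d)\<^sup>2 = 1"
    using norm_mult_self[OF positive_adj[OF d(1)]] norm_adj_mult_self[of "adj z"] d(2) z
    by (simp add: adj_adj)
  then have "norm d \<le> 1" using norm_ge_zero[of d] by (auto simp: power2_eq_1_iff)
  then have act: "norm (x - z * adj z * x) \<le> norm x" for x
    using square_action[OF positive_adj[OF d(1)], of x] by (simp add: d(2))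
  define y where "y n = ((\<lambda>x. x - z * adj z * x) ^^ n) z" for n
  have y_le: "norm (y n) \<le> 1" for n
    by (induction n) (use z act order_trans in \<open>auto simp: y_def\<close>)
  \<comment> \<open>As \<open>adj z (1 - v) = (1 - w) adj z\<close>, this is
    \<open>- w (1 - w)^n = c^2 (1 + c^2)^n\<close>.\<close>
  define e where "e n = - (adj z * y n)" for n
  have e_le: "norm (e n) \<le> 1" for n
    using norm_mult_ineq[of "adj z" "y n"] y_le[of n] z by (simp add: e_def)
  have e_Suc: "e (Suc n) = e n + c * c * e n" for n
  proof -
    have "e (Suc n) = e n + (adj z * z) * (adj z * y n)"
      by (simp add: e_def y_def algebra_simps)
    then show ?thesis by (simp add: zc e_def)
  qed
  \<comment> \<open>\<open>E\<close> collects the later binomial terms; it must commute with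
    \<open>c\<close> for \<open>c * c * E\<close> to be again a square of a self-adjoint
    element.\<close>
  have "\<exists>E. positive_element E \<and> E * c = c * E \<and> e n = c * c + n *\<^sub>R (c * c * (c * c)) + E" for n
  proof (induction n)
    case 0
    show ?case by (rule exI[of _ 0]) (simp add: e_def y_def zc)
  next
    case (Suc n)
    then obtain E where E: "positive_element E" "E * c = c * E" "e n = c * c + n *\<^sub>R (c * c * (c * c)) + E"
      by blast
    obtain r where r: "positive_element r" "r * r = E" "c * r = r * c"
      using positive_sqrt[OF E(1)] E(2) by metis
    have "c * c * E = (c * r) * (c * r)"
      by (metis r(2,3) mult.assoc)
    moreover have "adj (c * r) = c * r" using r c by (simp add: adj_mult positive_adj)
    ultimately have pE: "positive_element (c * c * E)" by (metis positive_square)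
    have "positive_element ((c * c * c) * (c * c * c))"
      by (rule positive_square) (simp add: adj_mult c mult.assoc)
    then have "positive_element (E + c * c * E + n *\<^sub>R ((c * c * c) * (c * c * c)))"
      by (intro positive_add positive_scaleR E pE) simp_all
    moreover have Ec: "E * (c * x) = c * (E * x)" for x
      by (metis E(2) mult.assoc)
    moreover have "(E + c * c * E + n *\<^sub>R ((c * c * c) * (c * c * c))) * c
        = c * (E + c * c * E + n *\<^sub>R ((c * c * c) * (c * c * c)))"
      by (simp add: algebra_simps E(2) Ec)
    moreover have "e (Suc n) = c * c + Suc n *\<^sub>R (c * c * (c * c))
        + (E + c * c * E + n *\<^sub>R ((c * c * c) * (c * c * c)))"
      unfolding e_Suc E(3) by (simp add: algebra_simps)
    ultimately show ?case by blast
  qed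
  then have bound: "real n * (norm (c * c))\<^sup>2 \<le> 1" for n
  proof -
    obtain E where E: "positive_element E" "E * c = c * E" "e n = c * c + n *\<^sub>R (c * c * (c * c)) + E"
      using \<open>\<And>n. \<exists>E. _ n E\<close> by blast
    \<comment> \<open>Chosen so that \<open>?l * ?l\<close> is \<open>n c^4\<close>; the rest,
      \<open>c^2 + E\<close>, is the square of an element commuting with \<open>?l\<close>.\<close>
    let ?l = "sqrt n *\<^sub>R (c * c)"
    have "positive_element (c * c + E)" by (intro positive_add positive_square c E)
    moreover have "?l * (c * c + E) = (c * c + E) * ?l"
    proof -
      have "E * (c * c) = c * c * E" by (metis E(2) mult.assoc)
      then show ?thesis by (simp add: algebra_simps)
    qed
    ultimately obtain r where r: "positive_element r" "r * r = c * c + E" "?l * r = r * ?l"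
      using positive_sqrt by metis
    have "norm (?l * ?l) \<le> norm (?l * ?l + r * r)"
      by (rule norm_square_le_commuting) (use r c in \<open>auto simp: adj_simps positive_adj\<close>)
    also have "?l * ?l + r * r = e n"
      by (simp add: r(2) E(3) algebra_simps)
    also have "norm (?l * ?l) = real n * (norm (c * c))\<^sup>2"
      by (subst norm_mult_self) (use c in \<open>auto simp: adj_simps power_mult_distrib\<close>)
    finally show ?thesis using e_le[of n] by linarith
  qed
  have "(norm (c * c))\<^sup>2 = 0"
  proof (rule ccontr)
    assume "(norm (c * c))\<^sup>2 \<noteq> 0"
    then have "(norm (c * c))\<^sup>2 > 0" by simp
    then obtain n where "1 < real n * (norm (c * c))\<^sup>2"
      using reals_Archimedean3 by blast
    then show False using bound[of n] by linarith
  qed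
  then show "c = 0" using norm_mult_self[OF c] by simp
qed

lemma adj_mult_self_eq_neg_square:
  fixes z c :: "'a::cstar_algebra"
  assumes "adj c = c" "adj z * z = - (c * c)"
  shows "z = 0"
proof (rule ccontr)
  assume z: "z \<noteq> 0"
  let ?r = "1 / norm z"
  have "?r *\<^sub>R c = 0"
    by (rule adj_mult_self_eq_neg_square_aux[where z = "?r *\<^sub>R z"])
      (use z in \<open>auto simp: adj_scaleR assms\<close>)
  then have "adj z * z = 0" using z assms by simp
  then show False using z norm_adj_mult_self[of z] by simp
qed

text \<open>For \<open>y = x\<^sup>* x\<close> with negative part \<open>m\<close>, the element \<open>x m\<close> satisfies \<open>(x m)\<^sup>* (x m) = - m\<^sup>3\<close>.\<close>

lemma positive_adj_mult: "positive_element (adj x * x)"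
proof -
  define y where "y = adj x * x"
  have y: "adj y = y" by (simp add: y_def adj_simps)
  \<comment> \<open>\<open>k\<close> is the absolute value of \<open>y\<close>, so \<open>m\<close>
    below is the negative part of \<open>y\<close>.\<close>
  obtain k where k: "positive_element k" "k * k = y * y" "y * k = k * y"
    using positive_sqrt[OF positive_square[OF y]] by (metis mult.assoc)
  obtain s where s: "positive_element s" "s * s = k" "\<And>g. g * k = k * g \<Longrightarrow> g * s = s * g"
    using positive_sqrt[OF k(1)] by metis
  define m where "m = (1 / 2) *\<^sub>R (k - y)"
  have m: "adj m = m" using positive_adj[OF k(1)] y by (simp add: m_def adj_simps)
  have mk: "m * k = k * m" by (simp add: m_def algebra_simps k(3))
  have ym: "y * m = - (m * m)"
    by (simp add: m_def algebra_simps k(2,3)) (simp flip: scaleR_add_left)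
  have ky: "k = 2 *\<^sub>R m + y" by (simp add: m_def)
  have my: "m * y = y * m" by (simp add: m_def algebra_simps k(3))
  \<comment> \<open>This exhibits \<open>m^3\<close> as the square of the self-adjoint element
    \<open>m * s\<close>.\<close>
  have "(m * s) * (m * s) = m * m * k"
    by (metis s(2) s(3)[OF mk] mult.assoc)
  also have "\<dots> = m * m * m"
    by (simp add: ky algebra_simps my ym scaleR_2)
  finally have ms: "(m * s) * (m * s) = m * m * m" .
  have "adj (x * m) * (x * m) = m * (y * m)"
    by (simp add: adj_mult m y_def mult.assoc)
  also have "\<dots> = - ((m * s) * (m * s))" unfolding ms by (simp add: ym mult.assoc)
  finally have "x * m = 0"
    by (rule adj_mult_self_eq_neg_square[rotated])
      (simp add: adj_mult m positive_adj[OF s(1)] s(3)[OF mk])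
  then have "m * (y * m) = 0" by (simp add: y_def mult.assoc)
  then have "(m * m) * (m * m) = 0" by (simp add: ym mult.assoc)
  then have "m * m = 0" using norm_mult_self[of "m * m"] m by (simp add: adj_mult)
  then have "m = 0" using norm_mult_self[OF m] by simp
  then have "y = k" by (simp add: m_def)
  then show ?thesis using k(1) by (simp add: y_def)
qed

text \<open>For \<open>\<parallel>h + k\<parallel> \<le> M\<close> the element \<open>M h - h\<^sup>2\<close> is positive and commutes with \<open>h\<close>, so that
  \<open>\<parallel>h\<^sup>2\<parallel> \<le> \<parallel>M h\<parallel>\<close>.\<close>

lemma norm_mono_positive:
  assumes h: "positive_element h" and k: "positive_element k"
  shows "norm h \<le> norm (h + k)"
proof (rule dense_ge)
  fix M assume M: "norm (h + k) < M"
  then have M0: "M > 0" by (meson le_less_trans norm_ge_zero)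
  obtain l where l: "positive_element l" "l * l = h" using positive_sqrt[OF h] by blast
  obtain j where j: "positive_element j" "j * j = k" using positive_sqrt[OF k] by blast
  let ?s = "(1 / M) *\<^sub>R (h + k)"
  have "adj ?s = ?s" using h k by (simp add: adj_simps positive_adj)
  moreover have "norm ?s \<le> 1" using M M0 by simp
  ultimately obtain f where f: "adj f = f" "f * f = 2 *\<^sub>R f - ?s"
    using contraction_sqrt by metis
  have ffx: "f * (f * y) = 2 *\<^sub>R (f * y) - ?s * y" for y
    using arg_cong[OF f(2), of "\<lambda>z. z * y"] by (simp add: algebra_simps)
  \<comment> \<open>\<open>?w\<close> is \<open>(1 - f) l\<close> with
    \<open>(1 - f)^2 = 1 - (h + k) / M\<close>. Adding \<open>l k l\<close> to
    \<open>M h - l (h + k) l\<close> cancels \<open>k\<close> and leaves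
    \<open>M h - h^2\<close>.\<close>
  let ?w = "l - f * l"
  have "adj ?w * ?w = l * l - l * (?s * l)"
    using l(1) by (simp add: adj_simps f(1) positive_adj algebra_simps ffx scaleR_2)
  then have "M *\<^sub>R (adj ?w * ?w) = M *\<^sub>R (l * l) - l * ((h + k) * l)"
    using M0 by (simp add: scaleR_diff_right)
  moreover have "adj (j * l) * (j * l) = l * (j * (j * l))"
    using l(1) j(1) by (simp add: adj_mult positive_adj mult.assoc)
  ultimately have "M *\<^sub>R (adj ?w * ?w) + adj (j * l) * (j * l)
      = M *\<^sub>R (l * l) - l * ((h + k) * l) + l * (j * (j * l))"
    by simp
  also have "\<dots> = M *\<^sub>R h - h * h"
    by (simp add: algebra_simps flip: l(2) j(2))
  finally have "positive_element (M *\<^sub>R h - h * h)"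
    using positive_add[OF positive_scaleR[OF positive_adj_mult[of ?w]] positive_adj_mult[of "j * l"], of M] M0
    by simp
  moreover have "h * (M *\<^sub>R h - h * h) = (M *\<^sub>R h - h * h) * h"
    by (simp add: algebra_simps)
  ultimately obtain r where r: "positive_element r" "r * r = M *\<^sub>R h - h * h" "h * r = r * h"
    using positive_sqrt by metis
  have "norm (h * h) \<le> norm (h * h + r * r)"
    by (rule norm_square_le_commuting) (use h r in \<open>auto simp: positive_adj\<close>)
  then have "norm h * norm h \<le> M * norm h"
    using M0 h by (simp add: r(2) norm_mult_self positive_adj power2_eq_square)
  then show "norm h \<le> M" using M0 by (cases "norm h = 0") auto
qed

section \<open>The norm of the Hilbert module\<close>

text \<open>Every block of \<open>g\<close> is bounded in norm by the same block of
  \<open>h\<close>, so the Cauchy criterion carries over.\<close>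

lemma series_comparison:
  fixes g h :: "nat \<Rightarrow> 'a::cstar_algebra"
  assumes g: "\<And>n. positive_element (g n)" and hg: "\<And>n. positive_element (h n - g n)"
    and h: "summable h"
  shows "summable g" "norm (suminf g) \<le> norm (suminf h)"
proof -
  have fin: "norm (sum g I) \<le> norm (sum h I)" for I
    using norm_mono_positive[OF positive_sum[of I g, OF g] positive_sum[of I "\<lambda>n. h n - g n", OF hg]]
    by (simp add: sum_subtractf)
  show sg: "summable g"
    unfolding summable_Cauchy
  proof (intro allI impI)
    fix e :: real assume "e > 0"
    then obtain N where "\<And>m n. m \<ge> N \<Longrightarrow> norm (sum h {m..<n}) < e"
      using h unfolding summable_Cauchy by blast
    then show "\<exists>N. \<forall>m\<ge>N. \<forall>n. norm (sum g {m..<n}) < e"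
      using fin le_less_trans by blast
  qed
  show "norm (suminf g) \<le> norm (suminf h)"
    by (rule LIMSEQ_le[OF tendsto_norm[OF summable_LIMSEQ[OF sg]] tendsto_norm[OF summable_LIMSEQ[OF h]]])
      (use fin in blast)
qed

lemma hilbert_moduleD: "x \<in> hilbert_module \<Longrightarrow> summable (\<lambda>n. adj (x n) * x n)"
  by (simp add: hilbert_module_def)

lemma module_sums: "x \<in> hilbert_module \<Longrightarrow> (\<lambda>n. adj (x n) * x n) sums module_inner x x"
  unfolding module_inner_def by (rule summable_sums[OF hilbert_moduleD])

lemma module_sumsD:
  assumes "(\<lambda>n. adj (x n) * x n) sums l"
  shows "x \<in> hilbert_module" "module_inner x x = l"
  using assms by (auto simp: hilbert_module_def module_inner_def sums_iff)

lemma module_norm_nonneg [simp]: "0 \<le> module_norm x"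
  by (simp add: module_norm_def)

lemma module_norm_power2: "(module_norm x)\<^sup>2 = norm (module_inner x x)"
  by (simp add: module_norm_def)

text \<open>The difference is the square of \<open>r a - b / r\<close>. This does the work of
  Cauchy-Schwarz in the triangle inequality.\<close>

lemma module_add_dominated:
  fixes a b :: "'a::cstar_algebra"
  assumes "r > 0"
  shows "positive_element ((1 + r\<^sup>2) *\<^sub>R (adj a * a) + (1 + 1 / r\<^sup>2) *\<^sub>R (adj b * b) - adj (a + b) * (a + b))"
proof -
  have "(1 + r\<^sup>2) *\<^sub>R (adj a * a) + (1 + 1 / r\<^sup>2) *\<^sub>R (adj b * b) - adj (a + b) * (a + b)
    = adj (r *\<^sub>R a - (1 / r) *\<^sub>R b) * (r *\<^sub>R a - (1 / r) *\<^sub>R b)"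
    using assms by (simp add: adj_simps algebra_simps power2_eq_square)
  then show ?thesis by (simp only: positive_adj_mult)
qed

lemma module_add:
  fixes x y :: "nat \<Rightarrow> 'a::cstar_algebra"
  assumes x: "x \<in> hilbert_module" and y: "y \<in> hilbert_module"
  shows "(\<lambda>n. x n + y n) \<in> hilbert_module"
    and "module_norm (\<lambda>n. x n + y n) \<le> module_norm x + module_norm y"
proof -
  let ?s = "\<lambda>n. x n + y n"
  have sums: "(\<lambda>n. (1 + r\<^sup>2) *\<^sub>R (adj (x n) * x n) + (1 + 1 / r\<^sup>2) *\<^sub>R (adj (y n) * y n))
     sums ((1 + r\<^sup>2) *\<^sub>R module_inner x x + (1 + 1 / r\<^sup>2) *\<^sub>R module_inner y y)" for r
    by (intro sums_add sums_scaleR_right module_sums x y)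
  have cmp: "?s \<in> hilbert_module"
    "norm (module_inner ?s ?s) \<le> norm ((1 + r\<^sup>2) *\<^sub>R module_inner x x + (1 + 1 / r\<^sup>2) *\<^sub>R module_inner y y)"
    if "r > 0" for r
    using series_comparison[of "\<lambda>n. adj (?s n) * ?s n",
        OF positive_adj_mult module_add_dominated[OF that] sums_summable[OF sums]]
    unfolding sums_unique[OF sums, symmetric] by (simp_all only: hilbert_module_def mem_Collect_eq module_inner_def[of ?s])
  show "?s \<in> hilbert_module"
    using cmp(1)[of 1] by simp
  have le: "module_norm ?s \<le> X + Y" if X: "module_norm x < X" and Y: "module_norm y < Y" for X Y
  proof -
    have pos: "X > 0" "Y > 0" using X Y module_norm_nonneg by (meson le_less_trans)+
    \<comment> \<open>The minimizing choice, giving \<open>(X + Y)^2\<close>; \<open>X\<close> and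
      \<open>Y\<close> lie strictly above the norms to be positive.\<close>
    define r where "r = sqrt (Y / X)"
    have r: "r > 0" "r\<^sup>2 = Y / X" using pos by (auto simp: r_def)
    have "(module_norm ?s)\<^sup>2 \<le> norm ((1 + r\<^sup>2) *\<^sub>R module_inner x x + (1 + 1 / r\<^sup>2) *\<^sub>R module_inner y y)"
      using cmp(2)[OF r(1)] by (simp only: module_norm_power2)
    also have "\<dots> \<le> (1 + r\<^sup>2) * (module_norm x)\<^sup>2 + (1 + 1 / r\<^sup>2) * (module_norm y)\<^sup>2"
      by (rule order_trans[OF norm_triangle_ineq]) (simp add: module_norm_power2)
    also have "\<dots> \<le> (1 + r\<^sup>2) * X\<^sup>2 + (1 + 1 / r\<^sup>2) * Y\<^sup>2"
      using X Y by (intro add_mono mult_left_mono power_mono) auto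
    also have "\<dots> = (X + Y)\<^sup>2"
      unfolding r(2) using pos by (simp add: field_simps power2_eq_square)
    finally show ?thesis by (rule power2_le_imp_le) (use pos in simp)
  qed
  show "module_norm ?s \<le> module_norm x + module_norm y"
  proof (rule field_le_epsilon)
    fix e :: real assume "e > 0"
    then show "module_norm ?s \<le> module_norm x + module_norm y + e"
      using le[of "module_norm x + e / 2" "module_norm y + e / 2"] by simp
  qed
qed

lemma module_weight:
  fixes x :: "nat \<Rightarrow> 'a::cstar_algebra"
  assumes x: "x \<in> hilbert_module" and w: "\<And>n. \<bar>w n\<bar> \<le> C"
  shows "(\<lambda>n. w n *\<^sub>R x n) \<in> hilbert_module"
    and "module_norm (\<lambda>n. w n *\<^sub>R x n) \<le> C * module_norm x"
proof -
  have C: "C \<ge> 0" using w[of 0] by linarith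
  have dom: "positive_element (C\<^sup>2 *\<^sub>R (adj (x n) * x n) - adj (w n *\<^sub>R x n) * (w n *\<^sub>R x n))" for n
  proof -
    have "(w n)\<^sup>2 \<le> C\<^sup>2" using w[of n] by (metis abs_ge_zero power2_abs power_mono)
    then have "positive_element ((C\<^sup>2 - (w n)\<^sup>2) *\<^sub>R (adj (x n) * x n))"
      by (intro positive_scaleR positive_adj_mult) simp
    then show ?thesis by (simp add: adj_scaleR algebra_simps power2_eq_square)
  qed
  have sums: "(\<lambda>n. C\<^sup>2 *\<^sub>R (adj (x n) * x n)) sums (C\<^sup>2 *\<^sub>R module_inner x x)"
    by (intro sums_scaleR_right module_sums x)
  note cmp = series_comparison[OF positive_adj_mult dom sums_summable[OF sums]]
  show "(\<lambda>n. w n *\<^sub>R x n) \<in> hilbert_module"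
    using cmp(1) by (simp add: hilbert_module_def)
  have "(module_norm (\<lambda>n. w n *\<^sub>R x n))\<^sup>2 \<le> norm (C\<^sup>2 *\<^sub>R module_inner x x)"
    using cmp(2) unfolding sums_unique[OF sums, symmetric]
    by (simp only: module_norm_power2 module_inner_def)
  also have "\<dots> = (C * module_norm x)\<^sup>2"
    by (simp add: power_mult_distrib module_norm_power2)
  finally show "module_norm (\<lambda>n. w n *\<^sub>R x n) \<le> C * module_norm x"
    by (rule power2_le_imp_le) (use C in simp)
qed

lemma module_diff:
  assumes x: "x \<in> hilbert_module" and y: "y \<in> hilbert_module"
  shows "(\<lambda>n. x n - y n) \<in> hilbert_module"
  using module_add(1)[OF x module_weight(1)[OF y, of "\<lambda>_. -1" 1]] by simp

section \<open>Prepended entries, the metric, tails and varying weights\<close>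

lemma module_cons:
  fixes x :: "nat \<Rightarrow> 'a::cstar_algebra"
  assumes x: "x \<in> hilbert_module"
  shows "case_nat c x \<in> hilbert_module"
    and "module_inner (case_nat c x) (case_nat c x) = module_inner x x + adj c * c"
proof -
  have "(\<lambda>n. adj (case_nat c x n) * case_nat c x n) sums (module_inner x x + adj c * c)"
    using sums_Suc[of "\<lambda>n. adj (case_nat c x n) * case_nat c x n"] module_sums[OF x] by simp
  then show "case_nat c x \<in> hilbert_module"
    "module_inner (case_nat c x) (case_nat c x) = module_inner x x + adj c * c"
    by (rule module_sumsD)+
qed

lemma module_norm_cons_0: "x \<in> hilbert_module \<Longrightarrow> module_norm (case_nat 0 x) = module_norm x"
  by (simp add: module_norm_def module_cons)

lemma module_norm_cons_le:
  assumes "x \<in> hilbert_module"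
  shows "module_norm (case_nat c x) \<le> norm c + module_norm x"
proof (rule power2_le_imp_le)
  have "(module_norm (case_nat c x))\<^sup>2 \<le> (module_norm x)\<^sup>2 + (norm c)\<^sup>2"
    unfolding module_norm_power2 module_cons(2)[OF assms]
    by (rule order_trans[OF norm_triangle_ineq]) (simp add: norm_adj_mult_self)
  also have "\<dots> \<le> (norm c + module_norm x)\<^sup>2"
    by (simp add: power2_sum)
  finally show "(module_norm (case_nat c x))\<^sup>2 \<le> (norm c + module_norm x)\<^sup>2" .
qed simp

text \<open>The series is compared with the one that keeps only its term at
  \<open>n\<close>.\<close>

lemma module_norm_eq_0:
  assumes z: "z \<in> hilbert_module" and "module_norm z = 0"
  shows "z n = 0"
proof -
  let ?g = "\<lambda>k. if k = n then adj (z k) * z k else 0"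
  have "norm (suminf ?g) \<le> norm (\<Sum>k. adj (z k) * z k)"
    by (rule series_comparison(2)[OF _ _ hilbert_moduleD[OF z]]) (auto intro: positive_adj_mult)
  also have "\<dots> = 0" using assms(2) by (simp add: module_norm_def module_inner_def)
  also have "suminf ?g = adj (z n) * z n"
    using sums_unique[OF sums_single[of n "\<lambda>k. adj (z k) * z k"]] by simp
  finally show ?thesis by (simp add: norm_adj_mult_self)
qed

lemma Metric_space_hilbert_module:
  "Metric_space (hilbert_module :: (nat \<Rightarrow> 'a::cstar_algebra) set) module_dist"
proof
  fix x y z :: "nat \<Rightarrow> 'a"
  show "0 \<le> module_dist x y" by (simp add: module_dist_def)
  have "adj (x n - y n) * (x n - y n) = adj (y n - x n) * (y n - x n)" for n
    by (simp add: adj_diff algebra_simps)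
  then show "module_dist x y = module_dist y x"
    by (simp add: module_dist_def module_norm_def module_inner_def)
  assume x: "x \<in> hilbert_module" and y: "y \<in> hilbert_module"
  show "module_dist x y = 0 \<longleftrightarrow> x = y"
  proof
    assume "module_dist x y = 0"
    then show "x = y"
      using module_norm_eq_0[OF module_diff[OF x y]] by (auto simp: module_dist_def fun_eq_iff)
  qed (simp add: module_dist_def module_norm_def module_inner_def)
  assume z: "z \<in> hilbert_module"
  show "module_dist x z \<le> module_dist x y + module_dist y z"
    using module_add(2)[OF module_diff[OF x y] module_diff[OF y z]] by (simp add: module_dist_def)
qed

lemma module_tail_small:
  fixes x :: "nat \<Rightarrow> 'a::cstar_algebra"
  assumes x: "x \<in> hilbert_module" and "e > 0"
  obtains K where "(\<lambda>n. if n < K then 0 else x n) \<in> hilbert_module"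
    "module_norm (\<lambda>n. if n < K then 0 else x n) < e"
proof -
  obtain K where K: "norm (\<Sum>i. adj (x (i + K)) * x (i + K)) < e\<^sup>2"
    using suminf_exist_split[OF _ hilbert_moduleD[OF x], of "e\<^sup>2"] \<open>e > 0\<close> by auto
  let ?z = "\<lambda>n. if n < K then 0 else x n"
  have z: "?z \<in> hilbert_module"
  proof -
    have "?z = (\<lambda>n. (if n < K then 0 else 1) *\<^sub>R x n)" by auto
    then show ?thesis using module_weight(1)[OF x, of "\<lambda>n. if n < K then 0 else 1" 1] by simp
  qed
  have "module_inner ?z ?z = (\<Sum>i. adj (x (i + K)) * x (i + K))"
    unfolding module_inner_def
    by (subst suminf_split_initial_segment[OF hilbert_moduleD[OF z], of K]) simp
  then have "(module_norm ?z)\<^sup>2 < e\<^sup>2" using K by (simp add: module_norm_power2)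
  then have "module_norm ?z < e" by (rule power2_less_imp_less) (use \<open>e > 0\<close> in simp)
  with z that show thesis by blast
qed

text \<open>Pointwise continuity controls finitely many coordinates; on a small tail, boundedness of
  the weights is enough.\<close>

lemma module_weight_continuous:
  fixes x :: "nat \<Rightarrow> 'a::cstar_algebra" and w :: "real \<Rightarrow> nat \<Rightarrow> real"
  assumes x: "x \<in> hilbert_module" and w: "\<And>s n. \<bar>w s n\<bar> \<le> 1"
    and cont: "\<And>n. isCont (\<lambda>s. w s n) t" and "e > 0"
  shows "\<forall>\<^sub>F s in nhds t. module_norm (\<lambda>n. (w s n - w t n) *\<^sub>R x n) < e"
proof -
  obtain K where z: "(\<lambda>n. if n < K then 0 else x n) \<in> hilbert_module"
    \<comment> \<open>Differences of weights are at most 2, so this tail contributes less than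
      \<open>e / 2\<close>.\<close>
    and zK: "module_norm (\<lambda>n. if n < K then 0 else x n) < e / 4"
    using module_tail_small[OF x, of "e / 4"] \<open>e > 0\<close> by auto
  let ?z = "\<lambda>n. if n < K then 0 else x n"
  define \<delta> where "\<delta> = e / (2 * (module_norm x + 1))"
  have N1: "module_norm x + 1 > 0" by (simp add: add_nonneg_pos)
  then have \<delta>: "\<delta> > 0" "\<delta> * module_norm x \<le> e / 2"
    using \<open>e > 0\<close> by (auto simp: \<delta>_def field_simps)
  have "\<forall>\<^sub>F s in nhds t. \<bar>w s n - w t n\<bar> < \<delta>" for n
  proof -
    have "((\<lambda>s. w s n) \<longlongrightarrow> w t n) (nhds t)"
      using cont[of n] by (simp add: isCont_def tendsto_at_iff_tendsto_nhds[of "\<lambda>s. w s n"])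
    from tendstoD[OF this \<delta>(1)] show ?thesis by (simp add: dist_real_def)
  qed
  then have "\<forall>\<^sub>F s in nhds t. \<forall>n\<in>{..<K}. \<bar>w s n - w t n\<bar> < \<delta>"
    by (intro eventually_ball_finite) auto
  then show ?thesis
  proof eventually_elim
    case (elim s)
    let ?a = "\<lambda>n. (if n < K then w s n - w t n else 0) *\<^sub>R x n"
    let ?b = "\<lambda>n. (w s n - w t n) *\<^sub>R ?z n"
    have a: "?a \<in> hilbert_module" "module_norm ?a \<le> \<delta> * module_norm x"
    proof -
      have "\<bar>if n < K then w s n - w t n else 0\<bar> \<le> \<delta>" for n
        using elim \<delta>(1) by (auto simp: less_imp_le)
      note module_weight[OF x this]
      then show "?a \<in> hilbert_module" "module_norm ?a \<le> \<delta> * module_norm x" .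
    qed
    have "\<bar>w s n - w t n\<bar> \<le> 2" for n using w[of s n] w[of t n] by linarith
    note b = module_weight[of _ "\<lambda>n. w s n - w t n", OF z this]
    have "(\<lambda>n. (w s n - w t n) *\<^sub>R x n) = (\<lambda>n. ?a n + ?b n)" by auto
    then have "module_norm (\<lambda>n. (w s n - w t n) *\<^sub>R x n) \<le> module_norm ?a + module_norm ?b"
      using module_add(2)[OF a(1) b(1)] by simp
    then show ?case using a(2) b(2) zK \<delta>(2) by linarith
  qed
qed

section \<open>Contraction of the sphere\<close>

text \<open>As \<open>h\<close> is nonexpansive in \<open>x\<close> uniformly in \<open>t\<close>,
  continuity in \<open>t\<close> for each fixed \<open>x\<close> gives joint continuity.\<close>

lemma (in Metric_space) continuous_map_nonexpansive_homotopy: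
  fixes h :: "real \<times> 'a \<Rightarrow> 'a"
  assumes S: "S \<subseteq> M"
    and maps: "\<And>t x. t \<in> {0..1} \<Longrightarrow> x \<in> S \<Longrightarrow> h (t, x) \<in> S"
    and nonexp: "\<And>t x y. t \<in> {0..1} \<Longrightarrow> x \<in> S \<Longrightarrow> y \<in> S \<Longrightarrow> d (h (t, x)) (h (t, y)) \<le> d x y"
    and cont: "\<And>t x e. t \<in> {0..1} \<Longrightarrow> x \<in> S \<Longrightarrow> e > 0 \<Longrightarrow> \<forall>\<^sub>F s in nhds t. d (h (s, x)) (h (t, x)) < e"
  shows "continuous_map (prod_topology (top_of_set {0..1}) (subtopology mtopology S)) (subtopology mtopology S) h"
proof (rule continuous_map_into_subtopology)
  show "h \<in> topspace (prod_topology (top_of_set {0..1}) (subtopology mtopology S)) \<rightarrow> S"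
    using maps by auto
  show "continuous_map (prod_topology (top_of_set {0..1}) (subtopology mtopology S)) mtopology h"
    unfolding continuous_map_to_metric
  proof (intro ballI allI impI)
    fix z :: "real \<times> 'a" and e :: real
    assume "z \<in> topspace (prod_topology (top_of_set {0..1}) (subtopology mtopology S))" and e: "e > 0"
    then obtain t x where z: "z = (t, x)" and t: "t \<in> {0..1}" and x: "x \<in> S" by auto
    obtain U where U: "open U" "t \<in> U" "\<And>s. s \<in> U \<Longrightarrow> d (h (s, x)) (h (t, x)) < e / 2"
      using cont[OF t x, of "e / 2"] e unfolding eventually_nhds by auto
    let ?W = "({0..1} \<inter> U) \<times> (S \<inter> mball x (e / 2))"
    have "openin (prod_topology (top_of_set {0..1}) (subtopology mtopology S)) ?W"
      unfolding openin_prod_Times_iff using U(1) by (auto simp: openin_open openin_subtopology_Int2)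
    moreover have "z \<in> ?W" using z t x U(2) S e by auto
    moreover have "h y \<in> mball (h z) e" if "y \<in> ?W" for y
    proof -
      obtain s v where y: "y = (s, v)" and s: "s \<in> {0..1}" "s \<in> U" and v: "v \<in> S" "d x v < e / 2"
        using \<open>y \<in> ?W\<close> by auto
      have M: "h (t, x) \<in> M" "h (s, x) \<in> M" "h (s, v) \<in> M"
        using maps[OF t x] maps[OF s(1) x] maps[OF s(1) v(1)] S by auto
      have "d (h (t, x)) (h (s, v)) \<le> d (h (t, x)) (h (s, x)) + d (h (s, x)) (h (s, v))"
        by (rule triangle[OF M])
      also have "\<dots> < e"
        using U(3)[OF s(2)] nonexp[OF s(1) x v(1)] v(2) commute[of "h (t, x)" "h (s, x)"] by simp
      finally show ?thesis using M by (simp add: y z)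
    qed
    ultimately show "\<exists>U. openin (prod_topology (top_of_set {0..1}) (subtopology mtopology S)) U \<and> z \<in> U \<and> (\<forall>y\<in>U. h y \<in> mball (h z) e)"
      by blast
  qed
qed

text \<open>\<open>shift_weight k\<close> falls from 1 to 0 on the interval \<open>[1/(k+2), 1/(k+1)]\<close>. As \<open>t\<close> runs over this interval,
  the coordinate \<open>x k\<close> is rotated from position \<open>k\<close> into position \<open>k + 1\<close>, which is vacant by then.\<close>

definition shift_weight :: "nat \<Rightarrow> real \<Rightarrow> real" where
  "shift_weight k t = max 0 (min 1 (real (k + 2) - real (k + 1) * real (k + 2) * t))"

text \<open>Square roots make the squared coefficients of \<open>x k\<close> at positions
  \<open>k\<close> and \<open>k + 1\<close> add up to 1.\<close>

definition shift_path :: "real \<Rightarrow> (nat \<Rightarrow> 'a::cstar_algebra) \<Rightarrow> nat \<Rightarrow> 'a" where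
  "shift_path t x n = sqrt (shift_weight n t) *\<^sub>R x n
     + case_nat 0 (\<lambda>k. sqrt (1 - shift_weight k t) *\<^sub>R x k) n"

lemma shift_weight_bounds: "0 \<le> shift_weight k t" "shift_weight k t \<le> 1"
  by (auto simp: shift_weight_def)

lemma shift_weight_0: "shift_weight k 0 = 1"
  by (simp add: shift_weight_def)

lemma shift_weight_1: "shift_weight k 1 = 0"
proof -
  have "0 \<le> real k * real k" by simp
  then have "- (real k * real k) - real k * 2 \<le> 0" by linarith
  then show ?thesis by (simp add: shift_weight_def algebra_simps)
qed

text \<open>Weight \<open>k + 1\<close> is nonzero only for \<open>t < 1/(k + 2)\<close>, where
  weight \<open>k\<close> has not begun to fall. Hence at most one summand of
  \<open>shift_path\<close> is nonzero at position \<open>k + 1\<close>.\<close>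

lemma shift_weight_orthogonal:
  assumes "shift_weight (Suc k) t \<noteq> 0"
  shows "shift_weight k t = 1"
proof -
  let ?a = "real (k + 2)"
  have "0 < real (k + 3) - ?a * real (k + 3) * t"
  proof (rule ccontr)
    assume "\<not> ?thesis"
    then have "shift_weight (Suc k) t = 0"
      unfolding shift_weight_def by (intro max_absorb1 min.coboundedI2) (simp add: add.commute)
    then show False using assms by simp
  qed
  also have "\<dots> = real (k + 3) * (1 - ?a * t)" by (simp add: algebra_simps)
  finally have "0 < real (k + 3) * (1 - ?a * t)" .
  then have "0 < 1 - ?a * t" by (rule zero_less_mult_pos) simp
  then have "0 \<le> real (k + 1) * (1 - ?a * t)"
    by (intro mult_nonneg_nonneg) auto
  moreover have "?a - real (k + 1) * ?a * t = 1 + real (k + 1) * (1 - ?a * t)"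
    by (simp add: algebra_simps)
  ultimately have "1 \<le> ?a - real (k + 1) * ?a * t"
    by (simp only: le_add_same_cancel1)
  then show ?thesis by (simp only: shift_weight_def min_absorb1)
qed

lemma isCont_shift_weight: "isCont (\<lambda>t. sqrt (shift_weight k t)) s" "isCont (\<lambda>t. sqrt (1 - shift_weight k t)) s"
  unfolding shift_weight_def by (intro continuous_intros)+

lemma shift_path_sq:
  "adj (shift_path t x n) * shift_path t x n = shift_weight n t *\<^sub>R (adj (x n) * x n)
     + case_nat 0 (\<lambda>k. (1 - shift_weight k t) *\<^sub>R (adj (x k) * x k)) n"
proof (cases n)
  case 0
  then show ?thesis by (simp add: shift_path_def adj_simps shift_weight_bounds)
next
  case (Suc k)
  have "shift_weight (Suc k) t = 0 \<or> shift_weight k t = 1" using shift_weight_orthogonal by blast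
  then show ?thesis
    using Suc by (auto simp: shift_path_def adj_simps shift_weight_bounds)
qed

text \<open>The weighted series has some sum \<open>A\<close>, the complementary one
  \<open>module_inner x x - A\<close>, and prepending 0 does not change the latter.\<close>

lemma shift_path_isometric:
  fixes x :: "nat \<Rightarrow> 'a::cstar_algebra"
  assumes x: "x \<in> hilbert_module"
  shows "shift_path t x \<in> hilbert_module" "module_inner (shift_path t x) (shift_path t x) = module_inner x x"
proof -
  let ?w = "\<lambda>k. shift_weight k t" and ?q = "\<lambda>k. adj (x k) * x k"
  have "(\<lambda>n. sqrt (?w n) *\<^sub>R x n) \<in> hilbert_module"
    by (rule module_weight(1)[OF x, of _ 1]) (simp add: shift_weight_bounds)
  from hilbert_moduleD[OF this] have "summable (\<lambda>n. ?w n *\<^sub>R ?q n)"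
    by (simp add: adj_scaleR shift_weight_bounds)
  then obtain A where A: "(\<lambda>n. ?w n *\<^sub>R ?q n) sums A" by blast
  have "(\<lambda>n. (1 - ?w n) *\<^sub>R ?q n) sums (module_inner x x - A)"
    using sums_diff[OF module_sums[OF x] A] by (simp add: scaleR_diff_left)
  then have "case_nat 0 (\<lambda>n. (1 - ?w n) *\<^sub>R ?q n) sums (module_inner x x - A)"
    using sums_Suc[of "case_nat 0 (\<lambda>n. (1 - ?w n) *\<^sub>R ?q n)"] by simp
  from sums_add[OF A this] have "(\<lambda>n. adj (shift_path t x n) * shift_path t x n) sums module_inner x x"
    by (simp add: shift_path_sq)
  then show "shift_path t x \<in> hilbert_module" "module_inner (shift_path t x) (shift_path t x) = module_inner x x"
    by (rule module_sumsD)+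
qed

lemma shift_path_diff: "shift_path t (\<lambda>n. x n - y n) n = shift_path t x n - shift_path t y n"
  by (simp add: shift_path_def algebra_simps split: nat.split)

lemma shift_path_continuous:
  fixes x :: "nat \<Rightarrow> 'a::cstar_algebra"
  assumes x: "x \<in> hilbert_module" and "e > 0"
  shows "\<forall>\<^sub>F s in nhds t. module_dist (shift_path s x) (shift_path t x) < e"
proof -
  let ?a = "\<lambda>s n. sqrt (shift_weight n s)" and ?b = "\<lambda>s n. sqrt (1 - shift_weight n s)"
  have ab: "\<bar>?a s n\<bar> \<le> 1" "\<bar>?b s n\<bar> \<le> 1" for s n
    by (simp_all add: shift_weight_bounds)
  have "e / 2 > 0" using \<open>e > 0\<close> by simp
  then have "\<forall>\<^sub>F s in nhds t. module_norm (\<lambda>n. (?a s n - ?a t n) *\<^sub>R x n) < e / 2"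
    "\<forall>\<^sub>F s in nhds t. module_norm (\<lambda>n. (?b s n - ?b t n) *\<^sub>R x n) < e / 2"
    using module_weight_continuous[of x ?a t] module_weight_continuous[of x ?b t]
      x ab isCont_shift_weight by blast+
  then show ?thesis
  proof eventually_elim
    case (elim s)
    let ?u = "\<lambda>n. (?a s n - ?a t n) *\<^sub>R x n" and ?v = "\<lambda>n. (?b s n - ?b t n) *\<^sub>R x n"
    have "\<bar>?a s n - ?a t n\<bar> \<le> 2" "\<bar>?b s n - ?b t n\<bar> \<le> 2" for n
      using ab(1)[of n s] ab(1)[of n t] ab(2)[of n s] ab(2)[of n t] by linarith+
    note uv = module_weight(1)[of _ "\<lambda>n. ?a s n - ?a t n", OF x this(1)]
      module_weight(1)[of _ "\<lambda>n. ?b s n - ?b t n", OF x this(2)]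
    have "(\<lambda>n. shift_path s x n - shift_path t x n) = (\<lambda>n. ?u n + case_nat 0 ?v n)"
      by (auto simp: shift_path_def algebra_simps split: nat.split)
    then have "module_dist (shift_path s x) (shift_path t x) \<le> module_norm ?u + module_norm (case_nat 0 ?v)"
      using module_add(2)[OF uv(1) module_cons(1)[OF uv(2), of 0]] by (simp add: module_dist_def)
    then show ?case using elim module_norm_cons_0[OF uv(2)] by linarith
  qed
qed

theorem theorem3p1:
  fixes p :: "'a::cstar_algebra"
  assumes "projection p"
  shows "contractible_space (subtopology hilbert_module_topology (module_sphere p))"
proof -
  interpret Metric_space "hilbert_module :: (nat \<Rightarrow> 'a) set" module_dist
    by (rule Metric_space_hilbert_module)
  let ?S = "module_sphere p" and ?I = "top_of_set {0..1::real}"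
  let ?X = "subtopology mtopology ?S"
  have S: "?S \<subseteq> hilbert_module" by (auto simp: module_sphere_def)
  have p: "adj p * p = p" using assms by (simp add: projection_def)
  \<comment> \<open>\<open>H\<close> leads from the identity to the right shift, and
    \<open>G\<close> from there to the constant \<open>(p, 0, 0, ...)\<close>.\<close>
  define H where "H = (\<lambda>(t, x :: nat \<Rightarrow> 'a). shift_path t x)"
  define G where "G = (\<lambda>(t, x). case_nat (sqrt t *\<^sub>R p) (\<lambda>n. sqrt (1 - t) *\<^sub>R x n))"
  have "continuous_map (prod_topology ?I ?X) ?X H"
  proof (rule continuous_map_nonexpansive_homotopy[OF S])
    fix t :: real and x y :: "nat \<Rightarrow> 'a" and e :: real
    assume x: "x \<in> ?S"
    then show "H (t, x) \<in> ?S"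
      using shift_path_isometric[of x t] by (simp add: H_def module_sphere_def)
    show "\<forall>\<^sub>F s in nhds t. module_dist (H (s, x)) (H (t, x)) < e" if "e > 0"
      using shift_path_continuous[of x e t] x that S by (auto simp: H_def)
    show "module_dist (H (t, x)) (H (t, y)) \<le> module_dist x y" if "y \<in> ?S"
      \<comment> \<open>\<open>shift_path t\<close> respects differences and is isometric, so it
        preserves distances.\<close>
      using shift_path_isometric(2)[OF module_diff[OF subsetD[OF S x] subsetD[OF S that]], of t]
      by (simp add: H_def module_dist_def module_norm_def shift_path_diff[abs_def, symmetric])
  qed
  then have "homotopic_with (\<lambda>_. True) ?X ?X id (case_nat 0)"
    unfolding homotopic_with_def
    by (intro exI[of _ H])
      (auto simp: H_def fun_eq_iff shift_path_def shift_weight_0 shift_weight_1 split: nat.split)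
  moreover have "continuous_map (prod_topology ?I ?X) ?X G"
  proof (rule continuous_map_nonexpansive_homotopy[OF S])
    fix t :: real and x y :: "nat \<Rightarrow> 'a" and e :: real
    assume t: "t \<in> {0..1}" and "x \<in> ?S"
    then have x: "x \<in> hilbert_module" "module_inner x x = p" by (auto simp: module_sphere_def)
    have scale: "(\<lambda>n. r *\<^sub>R z n) \<in> hilbert_module" "module_norm (\<lambda>n. r *\<^sub>R z n) \<le> \<bar>r\<bar> * module_norm z"
      if "z \<in> hilbert_module" for r and z :: "nat \<Rightarrow> 'a"
      using module_weight[OF that, of "\<lambda>_. r" "\<bar>r\<bar>"] by auto
    have "(\<lambda>n. adj (sqrt (1 - t) *\<^sub>R x n) * (sqrt (1 - t) *\<^sub>R x n)) sums ((1 - t) *\<^sub>R p)"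
      using sums_scaleR_right[OF module_sums[OF x(1)], of "1 - t"] x(2) t by (simp add: adj_scaleR)
    note tx = module_sumsD[OF this]
    \<comment> \<open>The projection property enters here:
      \<open>(1 - t) p + t adj p p = p\<close>.\<close>
    show "G (t, x) \<in> ?S"
      using module_cons[OF tx(1), of "sqrt t *\<^sub>R p"] t
      by (simp add: G_def module_sphere_def tx(2) adj_scaleR p algebra_simps)
    show "\<forall>\<^sub>F s in nhds t. module_dist (G (s, x)) (G (t, x)) < e" if "e > 0"
    proof -
      \<comment> \<open>Here \<open>s\<close> may leave the unit interval; \<open>sqrt\<close>
        extends as an odd function and is continuous everywhere.\<close>
      let ?f = "\<lambda>s. \<bar>sqrt s - sqrt t\<bar> * norm p + \<bar>sqrt (1 - s) - sqrt (1 - t)\<bar> * module_norm x"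
      have "isCont ?f t" by (intro continuous_intros)
      then have "(?f \<longlongrightarrow> ?f t) (nhds t)"
        by (simp only: isCont_def tendsto_at_iff_tendsto_nhds[of ?f])
      then have "(?f \<longlongrightarrow> 0) (nhds t)" by simp
      then have "\<forall>\<^sub>F s in nhds t. ?f s < e" using that by (simp add: order_tendsto_iff)
      then show ?thesis
      proof eventually_elim
        case (elim s)
        have "(\<lambda>n. G (s, x) n - G (t, x) n)
          = case_nat ((sqrt s - sqrt t) *\<^sub>R p) (\<lambda>n. (sqrt (1 - s) - sqrt (1 - t)) *\<^sub>R x n)"
          by (auto simp: G_def algebra_simps split: nat.split)
        then have "module_dist (G (s, x)) (G (t, x))
          \<le> norm ((sqrt s - sqrt t) *\<^sub>R p) + module_norm (\<lambda>n. (sqrt (1 - s) - sqrt (1 - t)) *\<^sub>R x n)"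
          unfolding module_dist_def by (simp only: module_norm_cons_le[OF scale(1)[OF x(1)]])
        then show ?case using elim scale(2)[OF x(1), of "sqrt (1 - s) - sqrt (1 - t)"] by simp
      qed
    qed
    show "module_dist (G (t, x)) (G (t, y)) \<le> module_dist x y" if "y \<in> ?S"
    proof -
      have xy: "(\<lambda>n. x n - y n) \<in> hilbert_module" using x that by (auto simp: module_sphere_def intro: module_diff)
      \<comment> \<open>The first entries do not depend on the point and cancel.\<close>
      have "(\<lambda>n. G (t, x) n - G (t, y) n) = case_nat 0 (\<lambda>n. sqrt (1 - t) *\<^sub>R (x n - y n))"
        by (auto simp: G_def algebra_simps split: nat.split)
      then have "module_dist (G (t, x)) (G (t, y)) = module_norm (\<lambda>n. sqrt (1 - t) *\<^sub>R (x n - y n))"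
        unfolding module_dist_def using module_norm_cons_0[OF scale(1)[OF xy]] by simp
      also have "\<dots> \<le> sqrt (1 - t) * module_dist x y"
        using scale(2)[OF xy, of "sqrt (1 - t)"] t by (simp add: module_dist_def)
      also have "\<dots> \<le> module_dist x y"
        using t by (intro mult_left_le_one_le) (auto simp: module_dist_def)
      finally show ?thesis .
    qed
  qed
  then have "homotopic_with (\<lambda>_. True) ?X ?X (case_nat 0) (\<lambda>x. case_nat p (\<lambda>_. 0))"
    unfolding homotopic_with_def
    by (intro exI[of _ G]) (auto simp: G_def fun_eq_iff split: nat.split)
  ultimately show ?thesis
    unfolding contractible_space_def hilbert_module_topology_def using homotopic_with_trans by blast
qed

end
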